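(* Let $\beta<1$ be real, let $f(z)=z+\sum_{n=2}^{\infty}a_nz^n\in\mathcal{R}(\beta)$, and let $\lambda\in\mathbb{R}$. Then for all integers $n,m\ge2$, $$|\lambda a_na_m-a_{n+m-1}|\le\begin{cases}\dfrac{2(1-\beta)}{n+m-1}, & 0\le\lambda\le\dfrac{nm}{(1-\beta)(n+m-1)},\\[3mm] \left|\dfrac{4\lambda(1-\beta)^2}{nm}-\dfrac{2(1-\beta)}{n+m-1}\right|, & \text{for all other real }\lambda.\end{cases}$$ The result is sharp: for every real $\beta<1$, every real $\lambda$ and all integers $n,m\ge2$, there is a function in $\mathcal{R}(\beta)$ for which equality holds.
   Context: $\mathbb{D}$ is the open unit disc and $\mathcal{A}$ is the class of analytic functions on $\mathbb{D}$ of the form $f(z)=z+a_2z^2+a_3z^3+\cdots$. For real $\beta<1$, $\mathcal{R}(\beta)$ is the class of $f\in\mathcal{A}$ with $\operatorname{Re} f'(z)>\beta$ for all $z\in\mathbb{D}$. *)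

theory Defs
  imports "HOL-Complex_Analysis.Complex_Analysis"
begin

abbreviation unit_disc :: "complex set" ("\<D>")
  where "\<D> \<equiv> ball 0 1"

text \<open>
  \<open>f(z) = z + a\<^sub>2 z\<^sup>2 + a\<^sub>3 z\<^sup>3 + \<dots>\<close> on the unit disc.  The values \<open>a 0\<close> and \<open>a 1\<close> are irrelevant;
  for \<open>n \<ge> 2\<close>, \<open>a n\<close> is determined by \<open>f\<close>.
\<close>
definition normalized_expansion :: "(complex \<Rightarrow> complex) \<Rightarrow> (nat \<Rightarrow> complex) \<Rightarrow> bool"
  where "normalized_expansion f a \<longleftrightarrow>
    (\<forall>z\<in>\<D>. (\<lambda>k. a (k + 2) * z ^ (k + 2)) sums (f z - z))"

definition class_A :: "(complex \<Rightarrow> complex) set"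
  where "class_A = {f. f analytic_on \<D> \<and> (\<exists>a. normalized_expansion f a)}"

definition class_R :: "real \<Rightarrow> (complex \<Rightarrow> complex) set"
  where "class_R \<beta> = {f \<in> class_A. \<forall>z\<in>\<D>. Re (deriv f z) > \<beta>}"

end

theory Submission
  imports Defs
begin

text \<open>
  The function \<open>p = (f' - \<beta>) / (1 - \<beta>)\<close> has positive real part and \<open>p 0 = 1\<close>, and if
  \<open>p z = 1 + c\<^sub>1 z + c\<^sub>2 z\<^sup>2 + \<dots>\<close> then \<open>a\<^sub>n = (1 - \<beta>) c\<^bsub>n-1\<^esub> / n\<close>.  With \<open>j = n - 1\<close>, \<open>k = m - 1\<close> and
  \<open>\<nu> = \<mu> (1 - \<beta>) (n + m - 1) / (n m)\<close> this gives
  \<open>\<mu> a\<^sub>n a\<^sub>m - a\<^bsub>n+m-1\<^esub> = (1 - \<beta>) / (n + m - 1) (\<nu> c\<^sub>j c\<^sub>k - c\<^bsub>j+k\<^esub>)\<close>, and the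
  case distinction of the theorem becomes \<open>0 \<le> \<nu> \<le> 1\<close>.

  So everything is about \<open>\<bar>\<nu> c\<^sub>j c\<^sub>k - c\<^bsub>j+k\<^esub>\<bar>\<close> for functions with positive real part.
  It suffices to know Caratheodory's bound \<open>\<bar>c\<^sub>k\<bar> \<le> 2\<close> and Livingston's bound
  \<open>\<bar>c\<^sub>j c\<^sub>k - c\<^bsub>j+k\<^esub>\<bar> \<le> 2\<close>: these are the cases \<open>\<nu> = 0\<close> and \<open>\<nu> = 1\<close>, the range between them
  follows by convexity, and outside of \<open>[0, 1]\<close> the triangle inequality with
  \<open>\<bar>c\<^sub>j c\<^sub>k\<bar> \<le> 4\<close> already gives the best constant (\<open>norm_coeff_functional_le\<close>).

  Both bounds come from one observation.  On the circle of radius \<open>r < 1\<close>, the function \<open>Re p\<close>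
  is the density of a probability measure, whose moments are the numbers \<open>c\<^sub>k r\<^sup>k / 2\<close>
  (\<open>has_integral_Re_moment\<close>).  For unimodular \<open>X\<close> and \<open>Y\<close> on a probability space, the mean square of
  \<open>X - 2 E X\<close> equals 1, so \<open>\<bar>E (X Y) - 2 E X E Y\<bar> = \<bar>E ((X - 2 E X) Y)\<bar> \<le> 1\<close>
  (\<open>norm_product_moment_le_1\<close>).  Taking powers of \<open>exp (- i \<theta>)\<close> for \<open>X\<close> and \<open>Y\<close> and letting
  \<open>r\<close> tend to 1 yields Livingston's bound.

  Equality is attained by the functions with \<open>p z = (1 + z\<^sup>N) / (1 - z\<^sup>N)\<close>, whose coefficients are
  \<open>2\<close> at the positive multiples of \<open>N\<close> and \<open>0\<close> elsewhere: \<open>N = j + k\<close> kills \<open>c\<^sub>j c\<^sub>k\<close>, and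
  \<open>N = 1\<close> makes all three coefficients equal to \<open>2\<close>.
\<close>

section \<open>Moments of unimodular functions\<close>

lemma norm_moment_le_1:
  fixes w :: "'n::euclidean_space \<Rightarrow> real" and Y :: "'n \<Rightarrow> complex"
  assumes w: "(w has_integral 1) S" "\<And>t. t \<in> S \<Longrightarrow> w t \<ge> 0"
    and Y: "((\<lambda>t. of_real (w t) * Y t) has_integral y) S" "\<And>t. t \<in> S \<Longrightarrow> norm (Y t) = 1"
  shows "norm y \<le> 1"
proof -
  have "norm (of_real (w t) * Y t) \<le> w t \<bullet> 1" if "t \<in> S" for t
    using w(2)[OF that] Y(2)[OF that] by (simp add: norm_mult)
  from has_integral_norm_bound_integral_component[OF Y(1) w(1) this] show ?thesis by simp
qed

text \<open>
  Write \<open>E\<close> for the integral against \<open>w\<close>.  Since \<open>\<bar>Y\<bar> = 1\<close>, the quantity \<open>E ((X - 2 x) Y)\<close> is at most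
  \<open>E \<bar>X - 2 x\<bar> \<le> (1 + E \<bar>X - 2 x\<bar>\<^sup>2) / 2\<close>, and expanding the square with \<open>\<bar>X\<bar> = 1\<close> and
  \<open>E X = x\<close> gives \<open>E \<bar>X - 2 x\<bar>\<^sup>2 = 1 - 4 \<bar>x\<bar>\<^sup>2 + 4 \<bar>x\<bar>\<^sup>2 = 1\<close>.
\<close>
lemma norm_product_moment_le_1:
  fixes w :: "'n::euclidean_space \<Rightarrow> real" and X Y :: "'n \<Rightarrow> complex"
  assumes w: "(w has_integral 1) S" "\<And>t. t \<in> S \<Longrightarrow> w t \<ge> 0"
    and X: "((\<lambda>t. of_real (w t) * X t) has_integral x) S" "\<And>t. t \<in> S \<Longrightarrow> norm (X t) = 1"
    and Y: "((\<lambda>t. of_real (w t) * Y t) has_integral y) S" "\<And>t. t \<in> S \<Longrightarrow> norm (Y t) = 1"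
    and XY: "((\<lambda>t. of_real (w t) * (X t * Y t)) has_integral z) S"
  shows "norm (z - 2 * x * y) \<le> 1"
proof -
  have lhs: "((\<lambda>t. of_real (w t) * ((X t - 2 * x) * Y t)) has_integral (z - 2 * x * y)) S"
    using has_integral_diff[OF XY has_integral_mult_right[OF Y(1), of "2 * x"]]
    by (simp add: algebra_simps)
  have "((\<lambda>t. Re (cnj x * (of_real (w t) * X t))) has_integral Re (cnj x * x)) S"
    by (rule has_integral_linear[OF has_integral_mult_right[OF X(1)] bounded_linear_Re,
          unfolded o_def])
  moreover have "Re (cnj x * x) = (norm x)\<^sup>2"
    by (simp only: cmod_power2) (simp add: power2_eq_square)
  ultimately have lin:
    "((\<lambda>t. Re (cnj x * (of_real (w t) * X t))) has_integral (norm x)\<^sup>2) S"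
    by simp
  have rhs: "((\<lambda>t. w t * (1 + 2 * (norm x)\<^sup>2) - 2 * Re (cnj x * (of_real (w t) * X t)))
      has_integral (1 * (1 + 2 * (norm x)\<^sup>2) - 2 * (norm x)\<^sup>2)) S"
    by (intro has_integral_diff has_integral_mult_left has_integral_mult_right w(1) lin)
  have "norm (of_real (w t) * ((X t - 2 * x) * Y t))
      \<le> (w t * (1 + 2 * (norm x)\<^sup>2) - 2 * Re (cnj x * (of_real (w t) * X t))) \<bullet> 1"
    if "t \<in> S" for t
  proof -
    define d where "d = norm (X t - 2 * x)"
    have "(norm (X t))\<^sup>2 = 1" using X(2)[OF that] by simp
    then have "(Re (X t))\<^sup>2 + (Im (X t))\<^sup>2 = 1" by (simp add: cmod_power2)
    then have d2: "d\<^sup>2 = 1 - 4 * Re (cnj x * X t) + 4 * (norm x)\<^sup>2"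
      unfolding d_def cmod_power2 by (simp add: power2_eq_square algebra_simps)
    have "0 \<le> (d - 1)\<^sup>2" by simp
    then have "d \<le> (1 + d\<^sup>2) / 2" by (simp add: power2_eq_square algebra_simps)
    also have "\<dots> = 1 + 2 * (norm x)\<^sup>2 - 2 * Re (cnj x * X t)" by (simp add: d2)
    finally have "w t * d \<le> w t * (1 + 2 * (norm x)\<^sup>2 - 2 * Re (cnj x * X t))"
      using w(2)[OF that] by (rule mult_left_mono)
    moreover have "norm (of_real (w t) * ((X t - 2 * x) * Y t)) = w t * d"
      using w(2)[OF that] Y(2)[OF that] by (simp add: norm_mult d_def)
    ultimately show ?thesis by (simp add: algebra_simps)
  qed
  from has_integral_norm_bound_integral_component[OF lhs rhs this] show ?thesis by simp
qed

section \<open>Taylor coefficients of functions with positive real part\<close>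

lemma has_integral_circle_coeff:
  assumes h: "h holomorphic_on ball 0 1" "h has_fps_expansion H" and r: "0 < r" "r < 1"
  shows "((\<lambda>t. h (circlepath 0 r t) / circlepath 0 r t ^ k) has_integral fps_nth H k) {0..1}"
proof -
  have sub: "cball 0 r \<subseteq> ball (0::complex) 1" "ball 0 r \<subseteq> ball (0::complex) 1" using r by auto
  have "((\<lambda>u. h u / (u - 0) ^ Suc k) has_contour_integral
      (2 * pi * \<i>) / fact k * (deriv ^^ k) h 0) (circlepath 0 r)"
    by (rule Cauchy_has_contour_integral_higher_derivative_circlepath)
      (use r h sub in \<open>auto intro: holomorphic_on_subset
         intro!: holomorphic_on_imp_continuous_on\<close>)
  then have "((\<lambda>t. h (circlepath 0 r t) / circlepath 0 r t ^ Suc k *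
        vector_derivative (circlepath 0 r) (at t)) has_integral
      (2 * pi * \<i>) * fps_nth H k) {0..1}"
    using fps_nth_fps_expansion[OF h(2), of k] by (simp add: has_contour_integral)
  from has_integral_mult_right[OF this, of "1 / (2 * pi * \<i>)"]
  have "((\<lambda>t. 1 / (2 * pi * \<i>) * (h (circlepath 0 r t) / circlepath 0 r t ^ Suc k *
        vector_derivative (circlepath 0 r) (at t))) has_integral fps_nth H k) {0..1}"
    by simp
  moreover have "1 / (2 * pi * \<i>) * (h (circlepath 0 r t) / circlepath 0 r t ^ Suc k *
        vector_derivative (circlepath 0 r) (at t)) = h (circlepath 0 r t) / circlepath 0 r t ^ k"
    for t
  proof -
    have "vector_derivative (circlepath 0 r) (at t) = 2 * pi * \<i> * circlepath 0 r t"
      unfolding vector_derivative_circlepath by (simp add: circlepath)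
    moreover have "circlepath 0 r t \<noteq> 0" using r by (simp add: circlepath)
    ultimately show ?thesis by simp
  qed
  ultimately show ?thesis by simp
qed

text \<open>
  The real part is \<open>(p + cnj p) / 2\<close>.  Integrated against \<open>exp (- 2 \<pi> i k t)\<close>, the first summand gives
  \<open>c\<^sub>k r\<^sup>k / 2\<close>; the second one gives half of the conjugated mean value of \<open>p z \<cdot> z\<^sup>k\<close>, divided by \<open>r\<^sup>k\<close>,
  which vanishes unless \<open>k = 0\<close>.
\<close>
lemma has_integral_Re_moment:
  assumes p: "p holomorphic_on ball 0 1" "p has_fps_expansion P" "p 0 = 1" and r: "0 < r" "r < 1"
  shows "((\<lambda>t. of_real (Re (p (circlepath 0 r t))) * cnj (circlepath 0 1 t) ^ k) has_integral
          (if k = 0 then 1 else fps_nth P k * of_real r ^ k / 2)) {0..1}"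
proof -
  have P0: "fps_nth P 0 = 1" using p by (simp add: has_fps_expansion_imp_0_eq_fps_nth_0)
  have int1: "((\<lambda>t. p (circlepath 0 r t) / circlepath 0 r t ^ k * of_real r ^ k)
      has_integral fps_nth P k * of_real r ^ k) {0..1}"
    by (intro has_integral_mult_left has_integral_circle_coeff p r)
  have "((\<lambda>t. p (circlepath 0 r t) * circlepath 0 r t ^ k / circlepath 0 r t ^ 0)
      has_integral fps_nth (P * fps_X ^ k) 0) {0..1}"
    by (intro has_integral_circle_coeff[where h = "\<lambda>z. p z * z ^ k"] r
          holomorphic_intros p has_fps_expansion_mult has_fps_expansion_fps_X_power)
  from has_integral_mult_left[OF this, of "1 / of_real r ^ k"]
  have "((\<lambda>t. p (circlepath 0 r t) * circlepath 0 r t ^ k / of_real r ^ k) has_integral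
      (if k = 0 then 1 else 0)) {0..1}"
    by (cases "k = 0") (simp_all add: P0)
  then have int2: "((\<lambda>t. cnj (p (circlepath 0 r t) * circlepath 0 r t ^ k / of_real r ^ k))
      has_integral cnj (if k = 0 then 1 else 0)) {0..1}"
    by (rule has_integral_cnj[unfolded o_def, THEN iffD2])
  have split: "of_real (Re (p (circlepath 0 r t))) * cnj (circlepath 0 1 t) ^ k =
      (p (circlepath 0 r t) / circlepath 0 r t ^ k * of_real r ^ k +
       cnj (p (circlepath 0 r t) * circlepath 0 r t ^ k / of_real r ^ k)) / 2" for t
  proof -
    \<comment> \<open>On the unit circle, conjugation inverts \<open>e\<close>, which turns the factor \<open>z\<^sup>k\<close> under the conjugate
      and the factor \<open>1 / z\<^sup>k\<close> into the same
      function of \<open>t\<close>, up to powers of \<open>r\<close>.\<close>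
    define e where "e = circlepath 0 1 t"
    define q where "q = p (circlepath 0 r t)"
    define R where "R = complex_of_real r ^ k"
    have "R \<noteq> 0" "cnj R = R" using r by (simp_all add: R_def)
    have "norm e = 1" by (simp add: e_def circlepath)
    then have "e ^ k \<noteq> 0" by auto
    have "e * cnj e = 1" using \<open>norm e = 1\<close> by (simp flip: complex_norm_square)
    then have cnj_e: "cnj e ^ k = 1 / e ^ k"
      using \<open>e ^ k \<noteq> 0\<close> by (simp add: eq_divide_eq flip: power_mult_distrib) (simp add: mult.commute)
    have "circlepath 0 r t = of_real r * e" by (simp add: e_def circlepath)
    then have pow: "circlepath 0 r t ^ k = R * e ^ k" by (simp add: R_def power_mult_distrib)
    have Re_q: "of_real (Re q) = (q + cnj q) / 2" by (simp add: complex_add_cnj)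
    show ?thesis
      unfolding pow e_def[symmetric] q_def[symmetric] R_def[symmetric] Re_q
      using \<open>R \<noteq> 0\<close> \<open>e ^ k \<noteq> 0\<close> by (simp add: cnj_e \<open>cnj R = R\<close> add_divide_distrib mult.commute)
  qed
  show ?thesis
    unfolding split using has_integral_divide[OF has_integral_add[OF int1 int2], of 2]
    by (cases "k = 0") (simp_all add: P0)
qed

lemma le_of_radial_bounds:
  fixes C D :: real
  assumes "\<And>r. 0 < r \<Longrightarrow> r < 1 \<Longrightarrow> C * r ^ N \<le> D"
  shows "C \<le> D"
proof (rule tendsto_upperbound)
  show "((\<lambda>r. C * r ^ N) \<longlongrightarrow> C) (at_left 1)"
    by (auto intro!: tendsto_eq_intros)
  show "\<forall>\<^sub>F r in at_left 1. C * r ^ N \<le> D"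
    using eventually_at_left_real[of 0 "1::real"] assms by (auto elim: eventually_mono)
qed auto

context
  fixes p :: "complex \<Rightarrow> complex" and P :: "complex fps"
  assumes p: "p holomorphic_on ball 0 1" "p has_fps_expansion P" "p 0 = 1"
    and Re_pos: "\<And>z. z \<in> ball 0 1 \<Longrightarrow> Re (p z) > 0"
begin

lemma Re_circle_density:
  assumes r: "0 < r" "r < 1"
  shows "((\<lambda>t. Re (p (circlepath 0 r t))) has_integral 1) {0..1}"
    and "Re (p (circlepath 0 r t)) \<ge> 0"
proof -
  show "((\<lambda>t. Re (p (circlepath 0 r t))) has_integral 1) {0..1}"
    using has_integral_linear[OF has_integral_Re_moment[OF p r, of 0] bounded_linear_Re]
    by (simp add: o_def)
  have "circlepath 0 r t \<in> ball 0 1" using r by (simp add: circlepath norm_mult)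
  from Re_pos[OF this] show "Re (p (circlepath 0 r t)) \<ge> 0" by simp
qed

lemma norm_cnj_circlepath_power: "norm (cnj (circlepath 0 1 t) ^ k) = 1"
  by (simp add: norm_power circlepath)

lemma Caratheodory_coeff_bound:
  assumes "k \<ge> 1"
  shows "norm (fps_nth P k) \<le> 2"
proof (rule le_of_radial_bounds)
  fix r :: real assume r: "0 < r" "r < 1"
  have "norm (fps_nth P k * of_real r ^ k / 2) \<le> 1"
    by (rule norm_moment_le_1[OF Re_circle_density[OF r] _ norm_cnj_circlepath_power])
      (use has_integral_Re_moment[OF p r, of k] assms in simp)
  then show "norm (fps_nth P k) * r ^ k \<le> 2" using r by (simp add: norm_mult norm_divide norm_power)
qed

lemma Livingston_coeff_bound:
  assumes "j \<ge> 1" "k \<ge> 1"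
  shows "norm (fps_nth P j * fps_nth P k - fps_nth P (j + k)) \<le> 2"
proof (rule le_of_radial_bounds)
  fix r :: real assume r: "0 < r" "r < 1"
  have "norm (fps_nth P (j + k) * of_real r ^ (j + k) / 2
      - 2 * (fps_nth P j * of_real r ^ j / 2) * (fps_nth P k * of_real r ^ k / 2)) \<le> 1"
    by (rule norm_product_moment_le_1[OF Re_circle_density[OF r]
          _ norm_cnj_circlepath_power _ norm_cnj_circlepath_power])
      (use has_integral_Re_moment[OF p r, of j] has_integral_Re_moment[OF p r, of k]
           has_integral_Re_moment[OF p r, of "j + k"] assms in \<open>simp_all add: power_add\<close>)
  also have "fps_nth P (j + k) * of_real r ^ (j + k) / 2
      - 2 * (fps_nth P j * of_real r ^ j / 2) * (fps_nth P k * of_real r ^ k / 2)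
      = - (fps_nth P j * fps_nth P k - fps_nth P (j + k)) * of_real (r ^ (j + k) / 2)"
    by (simp add: power_add field_simps)
  finally show "norm (fps_nth P j * fps_nth P k - fps_nth P (j + k)) * r ^ (j + k) \<le> 2"
    using r unfolding norm_mult norm_minus_cancel norm_of_real by simp
qed

text \<open>
  For \<open>u = c\<^sub>j c\<^sub>k\<close> and \<open>v = c\<^bsub>j+k\<^esub>\<close>, the point \<open>\<nu> u - v\<close> is a convex combination of \<open>u - v\<close> and \<open>- v\<close>
  if \<open>0 \<le> \<nu> \<le> 1\<close>.  For \<open>\<nu> > 1\<close> it is \<open>(\<nu> - 1) u\<close> away from \<open>u - v\<close>, and for \<open>\<nu> < 0\<close> it is
  \<open>\<nu> u\<close> away from \<open>- v\<close>.
\<close>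
lemma norm_coeff_functional_le:
  assumes "j \<ge> 1" "k \<ge> 1"
  shows "norm (of_real \<nu> * fps_nth P j * fps_nth P k - fps_nth P (j + k))
          \<le> (if 0 \<le> \<nu> \<and> \<nu> \<le> 1 then 2 else \<bar>4 * \<nu> - 2\<bar>)"
proof -
  define u where "u = fps_nth P j * fps_nth P k"
  define v where "v = fps_nth P (j + k)"
  have uv: "norm (u - v) \<le> 2" unfolding u_def v_def using assms by (rule Livingston_coeff_bound)
  have v: "norm v \<le> 2" unfolding v_def using assms by (intro Caratheodory_coeff_bound) simp
  have u: "norm u \<le> 2 * 2" unfolding u_def norm_mult
    using assms by (intro mult_mono Caratheodory_coeff_bound) simp_all
  have "norm (of_real \<nu> * u - v) \<le> (if 0 \<le> \<nu> \<and> \<nu> \<le> 1 then 2 else \<bar>4 * \<nu> - 2\<bar>)"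
  proof -
    consider "0 \<le> \<nu>" "\<nu> \<le> 1" | "\<nu> > 1" | "\<nu> < 0" by linarith
    then show ?thesis
    proof cases
      case 1
      have "of_real \<nu> * u - v = of_real \<nu> * (u - v) + of_real (1 - \<nu>) * (- v)"
        by (simp add: algebra_simps)
      then have "norm (of_real \<nu> * u - v) \<le> \<nu> * norm (u - v) + (1 - \<nu>) * norm v"
        using 1 norm_triangle_ineq[of "of_real \<nu> * (u - v)" "of_real (1 - \<nu>) * (- v)"]
        by (simp only: norm_mult norm_minus_cancel norm_of_real abs_of_nonneg diff_ge_0_iff_ge)
      also have "\<dots> \<le> \<nu> * 2 + (1 - \<nu>) * 2" using 1 uv v by (intro add_mono mult_left_mono) auto
      finally show ?thesis using 1 by simp
    next
      case 2
      have "of_real \<nu> * u - v = of_real (\<nu> - 1) * u + (u - v)" by (simp add: algebra_simps)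
      then have "norm (of_real \<nu> * u - v) \<le> (\<nu> - 1) * norm u + norm (u - v)"
        using 2 norm_triangle_ineq[of "of_real (\<nu> - 1) * u" "u - v"]
        by (simp only: norm_mult norm_of_real abs_of_pos diff_gt_0_iff_gt)
      also have "\<dots> \<le> (\<nu> - 1) * (2 * 2) + 2" using 2 uv u by (intro add_mono mult_left_mono) auto
      finally show ?thesis using 2 by simp
    next
      case 3
      have "norm (of_real \<nu> * u - v) \<le> (- \<nu>) * norm u + norm v"
        using 3 norm_triangle_ineq4[of "of_real \<nu> * u" v] by (simp add: norm_mult)
      also have "\<dots> \<le> (- \<nu>) * (2 * 2) + 2" using 3 v u by (intro add_mono mult_left_mono) auto
      finally show ?thesis using 3 by simp
    qed
  qed
  then show ?thesis by (simp add: u_def v_def mult.assoc)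
qed

end

section \<open>The class \<open>\<R>(\<beta>)\<close>\<close>

text \<open>
  Overwriting the two values that the expansion leaves free by \<open>0\<close> and \<open>1\<close> turns it into an ordinary
  power series for \<open>f\<close>, to which uniqueness of coefficients and termwise differentiation apply.
\<close>
lemma normalized_expansion_iff_sums:
  "normalized_expansion f a \<longleftrightarrow>
     (\<forall>z\<in>\<D>. (\<lambda>k. (a(0 := 0, 1 := 1)) k * z ^ k) sums f z)"
proof -
  have "(\<lambda>k. a (k + 2) * z ^ (k + 2)) sums (f z - z) \<longleftrightarrow>
      (\<lambda>k. (a(0 := 0, 1 := 1)) k * z ^ k) sums f z" for z
    using sums_iff_shift[of "\<lambda>k. (a(0 := 0, 1 := 1)) k * z ^ k" 2 "f z - z"]
    by (simp add: numeral_2_eq_2)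
  then show ?thesis by (simp add: normalized_expansion_def)
qed

lemma class_R_positive_real_part:
  assumes "\<beta> < 1" and f: "f \<in> class_R \<beta>" "normalized_expansion f a"
  obtains p P where "p holomorphic_on ball 0 1" "p has_fps_expansion P" "p 0 = 1"
    "\<And>z. z \<in> ball 0 1 \<Longrightarrow> Re (p z) > 0"
    "\<And>n. n \<ge> 2 \<Longrightarrow> a n = of_real ((1 - \<beta>) / real n) * fps_nth P (n - 1)"
proof
  define F where "F = Abs_fps (a(0 := 0, 1 := 1))"
  define p where "p = (\<lambda>z. (deriv f z - of_real \<beta>) * of_real (1 / (1 - \<beta>)))"
  define P where "P = (fps_deriv F - fps_const (of_real \<beta>)) * fps_const (of_real (1 / (1 - \<beta>)))"
  have "\<forall>\<^sub>F z in nhds 0. (\<lambda>k. fps_nth F k * z ^ k) sums f z"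
    using eventually_nhds_in_open[of \<D> 0] f(2)
    by (auto simp: normalized_expansion_iff_sums F_def elim!: eventually_mono)
  then have F: "f has_fps_expansion F" by (rule has_fps_expansionI)
  show P: "p has_fps_expansion P"
    unfolding p_def P_def by (intro fps_expansion_intros F)
  have hol: "f holomorphic_on \<D>"
    using f(1) by (simp add: class_R_def class_A_def analytic_imp_holomorphic)
  show "p holomorphic_on ball 0 1"
    unfolding p_def by (intro holomorphic_intros hol) auto
  have "fps_nth P 0 = of_real ((1 - \<beta>) * (1 / (1 - \<beta>)))"
    unfolding of_real_mult by (simp add: P_def F_def)
  then have "fps_nth P 0 = 1" using \<open>\<beta> < 1\<close> by simp
  then show "p 0 = 1" using P by (simp add: has_fps_expansion_imp_0_eq_fps_nth_0)
  show "Re (p z) > 0" if "z \<in> ball 0 1" for z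
  proof -
    have "Re (deriv f z) > \<beta>" using f(1) that by (simp add: class_R_def)
    then show ?thesis using \<open>\<beta> < 1\<close>
      unfolding p_def times_complex.sel minus_complex.sel Re_complex_of_real Im_complex_of_real
      by simp
  qed
  show "a n = of_real ((1 - \<beta>) / real n) * fps_nth P (n - 1)" if "n \<ge> 2" for n
  proof -
    have "fps_nth P (n - 1) = of_nat n * a n * of_real (1 / (1 - \<beta>))"
      using that by (simp add: P_def F_def of_nat_diff)
    moreover have "1 - complex_of_real \<beta> \<noteq> 0"
      using \<open>\<beta> < 1\<close> by (simp add: complex_eq_iff)
    ultimately show ?thesis using that by (simp add: field_simps)
  qed
qed

text \<open>
  The function with \<open>(f' - \<beta>) / (1 - \<beta>) = (1 + z\<^sup>N) / (1 - z\<^sup>N)\<close>.  Its expansion is found by integrating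
  the geometric series of \<open>z\<^sup>N\<close>, and it belongs to the class because \<open>w \<mapsto> (1 + w) / (1 - w)\<close> maps the
  disc into the right half plane.
\<close>
lemma class_R_extremal:
  assumes "\<beta> < 1" "N \<ge> 1"
  obtains f a where "f \<in> class_R \<beta>" "normalized_expansion f a"
    "\<And>n. n \<ge> 2 \<Longrightarrow>
      a n = of_real ((1 - \<beta>) / real n) * (if N dvd n - 1 then 2 else 0)"
proof
  define a :: "nat \<Rightarrow> complex"
    where "a n = of_real ((1 - \<beta>) / real n) * (if N dvd n - 1 then 2 else 0)" for n
  define b where "b = a(0 := 0, 1 := 1)"
  define f where "f z = (\<Sum>k. b k * z ^ k)" for z
  have summ: "summable (\<lambda>k. b k * z ^ k)" if "norm z < 1" for z
  proof (rule summable_comparison_test)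
    define C where "C = max 1 (2 * (1 - \<beta>))"
    have "norm (b k) \<le> C" for k
    proof (cases "k \<le> 1")
      case True
      then have "k = 0 \<or> k = 1" by auto
      then show ?thesis by (auto simp: b_def C_def)
    next
      case False
      then have "b k = a k" by (simp add: b_def)
      then have "norm (b k) \<le> (1 - \<beta>) / real k * 2"
        unfolding a_def using \<open>\<beta> < 1\<close> by (simp only: norm_mult norm_of_real) simp
      also have "\<dots> \<le> (1 - \<beta>) / 1 * 2"
        using False \<open>\<beta> < 1\<close> by (intro mult_right_mono divide_left_mono) auto
      finally show ?thesis by (simp add: C_def)
    qed
    then show "\<exists>M. \<forall>k\<ge>M. norm (b k * z ^ k) \<le> C * norm z ^ k"
      by (auto simp: norm_mult norm_power intro!: mult_right_mono)
    show "summable (\<lambda>k. C * norm z ^ k)"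
      using that by (intro summable_mult summable_geometric) simp
  qed
  show exp: "normalized_expansion f a"
    unfolding normalized_expansion_iff_sums b_def[symmetric] f_def
    using summ by (auto intro: summable_sums)
  have deriv_f: "(f has_field_derivative
      (of_real \<beta> + of_real (1 - \<beta>) * ((1 + z ^ N) / (1 - z ^ N)))) (at z)"
    if z: "norm z < 1" for z
  proof -
    have zN: "norm (z ^ N) < 1"
      using z \<open>N \<ge> 1\<close> by (simp add: norm_power power_less_one_iff)
    then have ne: "z ^ N \<noteq> 1" by auto
    define g where "g k = (if N dvd k then z ^ k else 0)" for k
    have "strict_mono (\<lambda>k. N * k)" using \<open>N \<ge> 1\<close> by (auto simp: strict_mono_def)
    moreover have "(\<lambda>k. g (N * k)) sums (1 / (1 - z ^ N))"
      using geometric_sums[OF zN] by (simp add: g_def power_mult)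
    ultimately have "g sums (1 / (1 - z ^ N))"
      by (subst (asm) sums_mono_reindex) (auto simp: g_def)
    \<comment> \<open>\<open>f'\<close> is \<open>2 (1 - \<beta>)\<close> times the geometric series of \<open>z\<^sup>N\<close>, except that its constant term
      is \<open>1 = 2 (1 - \<beta>) - (1 - 2 \<beta>)\<close>.\<close>
    then have "(\<lambda>k. of_real (2 * (1 - \<beta>)) * g k - (if k = 0 then of_real (1 - 2 * \<beta>) else 0)) sums
        (of_real (2 * (1 - \<beta>)) * (1 / (1 - z ^ N)) - of_real (1 - 2 * \<beta>))"
      by (intro sums_diff sums_mult sums_single)
    moreover have "of_real (2 * (1 - \<beta>)) * g k - (if k = 0 then of_real (1 - 2 * \<beta>) else 0)
        = diffs b k * z ^ k" for k
      by (cases "k = 0") (auto simp: diffs_def b_def a_def g_def field_simps simp del: of_nat_Suc)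
    moreover have "of_real (2 * (1 - \<beta>)) * (1 / (1 - z ^ N)) - of_real (1 - 2 * \<beta>)
        = of_real \<beta> + of_real (1 - \<beta>) * ((1 + z ^ N) / (1 - z ^ N))"
      using ne by (simp add: divide_simps) (simp add: algebra_simps)
    ultimately have "(\<lambda>k. diffs b k * z ^ k) sums
        (of_real \<beta> + of_real (1 - \<beta>) * ((1 + z ^ N) / (1 - z ^ N)))"
      by (simp only:)
    then show ?thesis
      using termdiffs_strong'[of 1 b z] summ z unfolding f_def by (simp add: sums_iff)
  qed
  have "f analytic_on \<D>"
    unfolding analytic_on_open[OF open_ball] holomorphic_on_open[OF open_ball]
    by (metis deriv_f mem_ball_0)
  moreover have "Re (deriv f z) > \<beta>" if "z \<in> \<D>" for z
  proof -
    have z: "norm z < 1" using that by simp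
    define w where "w = z ^ N"
    have w: "norm w < 1"
      using z \<open>N \<ge> 1\<close> by (simp add: w_def norm_power power_less_one_iff)
    then have "w \<noteq> 1" by auto
    have "(norm w)\<^sup>2 < 1" using w by (simp add: power_less_one_iff)
    have "Re ((1 + w) / (1 - w)) = (1 - (norm w)\<^sup>2) / (norm (1 - w))\<^sup>2"
      unfolding Re_divide cmod_power2 by (simp add: power2_eq_square algebra_simps)
    also have "\<dots> > 0" using \<open>(norm w)\<^sup>2 < 1\<close> \<open>w \<noteq> 1\<close> by simp
    finally have "(1 - \<beta>) * Re ((1 + w) / (1 - w)) > 0" using \<open>\<beta> < 1\<close> by simp
    moreover have "deriv f z = of_real \<beta> + of_real (1 - \<beta>) * ((1 + w) / (1 - w))"
      unfolding w_def by (rule DERIV_imp_deriv[OF deriv_f[OF z]])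
    ultimately show ?thesis
      by (simp only: plus_complex.sel times_complex.sel(1) Re_complex_of_real Im_complex_of_real)
  qed
  ultimately show "f \<in> class_R \<beta>" using exp by (auto simp: class_R_def class_A_def)
  show "a n = of_real ((1 - \<beta>) / real n) * (if N dvd n - 1 then 2 else 0)" if "n \<ge> 2" for n
    by (rule a_def)
qed

lemma coefficient_functional_rescale:
  fixes a c :: "nat \<Rightarrow> complex" and \<beta> \<mu> :: real
  assumes nm: "n \<ge> 2" "m \<ge> 2" and "\<beta> < 1"
    and a: "\<And>n. n \<ge> 2 \<Longrightarrow> a n = of_real ((1 - \<beta>) / real n) * c (n - 1)"
  defines "\<nu> \<equiv> \<mu> * (1 - \<beta>) * (real n + real m - 1) / (real n * real m)"
  shows "norm (of_real \<mu> * a n * a m - a (n + m - 1)) = (1 - \<beta>) / (real n + real m - 1) *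
    norm (of_real \<nu> * c (n - 1) * c (m - 1) - c ((n - 1) + (m - 1)))"
proof -
  define s where "s = real n + real m - 1"
  have s: "s > 0" "real (n + m - 1) = s" using nm by (auto simp: s_def of_nat_diff)
  have idx: "n + m - 1 - 1 = (n - 1) + (m - 1)" using nm by simp
  have \<nu>: "\<mu> * ((1 - \<beta>) / real n) * ((1 - \<beta>) / real m) = (1 - \<beta>) / s * \<nu>"
    using s nm by (simp add: \<nu>_def flip: s_def)
  have "of_real \<mu> * a n * a m - a (n + m - 1) =
      of_real (\<mu> * ((1 - \<beta>) / real n) * ((1 - \<beta>) / real m)) * c (n - 1) * c (m - 1)
        - of_real ((1 - \<beta>) / s) * c ((n - 1) + (m - 1))"
    using nm a[of n] a[of m] a[of "n + m - 1"] by (simp only: s idx) (simp add: mult_ac)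
  also have "\<dots> = of_real ((1 - \<beta>) / s) *
      (of_real \<nu> * c (n - 1) * c (m - 1) - c ((n - 1) + (m - 1)))"
    unfolding \<nu> by (simp add: algebra_simps)
  finally have "norm (of_real \<mu> * a n * a m - a (n + m - 1)) = \<bar>(1 - \<beta>) / s\<bar> *
      norm (of_real \<nu> * c (n - 1) * c (m - 1) - c ((n - 1) + (m - 1)))"
    by (simp only: norm_mult norm_of_real)
  moreover have "\<bar>(1 - \<beta>) / s\<bar> = (1 - \<beta>) / s" using s \<open>\<beta> < 1\<close> by simp
  ultimately show ?thesis by (simp only: s_def)
qed

lemma coefficient_bound_rescale:
  fixes n m :: nat and \<beta> \<mu> :: real
  assumes "n \<ge> 2" "m \<ge> 2" "\<beta> < 1"
  defines "\<nu> \<equiv> \<mu> * (1 - \<beta>) * (real n + real m - 1) / (real n * real m)"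
  shows "(if 0 \<le> \<mu> \<and> \<mu> \<le> (real n * real m) / ((1 - \<beta>) * (real n + real m - 1))
          then 2 * (1 - \<beta>) / (real n + real m - 1)
          else \<bar>4 * \<mu> * (1 - \<beta>)^2 / (real n * real m) - 2 * (1 - \<beta>) / (real n + real m - 1)\<bar>)
    = (1 - \<beta>) / (real n + real m - 1) * (if 0 \<le> \<nu> \<and> \<nu> \<le> 1 then 2 else \<bar>4 * \<nu> - 2\<bar>)"
proof -
  define s where "s = real n + real m - 1"
  define q where "q = real n * real m"
  have pos: "s > 0" "q > 0" "1 - \<beta> > 0" using assms by (auto simp: s_def q_def)
  then have pos': "(1 - \<beta>) * s > 0" by simp
  have \<nu>: "\<nu> = \<mu> * ((1 - \<beta>) * s) / q" by (simp add: \<nu>_def s_def q_def)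
  have "0 \<le> \<mu> \<longleftrightarrow> 0 \<le> \<nu>"
    unfolding \<nu> using pos(2) pos' by (metis zero_le_divide_iff zero_le_mult_iff less_le_not_le)
  moreover have "\<mu> \<le> q / ((1 - \<beta>) * s) \<longleftrightarrow> \<nu> \<le> 1"
    unfolding \<nu> using pos by (simp add: pos_le_divide_eq pos_divide_le_eq)
  moreover have "4 * \<mu> * (1 - \<beta>)^2 / q - 2 * (1 - \<beta>) / s = (1 - \<beta>) / s * (4 * \<nu> - 2)"
    unfolding \<nu> using pos by (simp add: field_simps power2_eq_square)
  moreover have "\<bar>(1 - \<beta>) / s * (4 * \<nu> - 2)\<bar> = (1 - \<beta>) / s * \<bar>4 * \<nu> - 2\<bar>"
    using pos by (simp add: abs_mult)
  ultimately show ?thesis unfolding s_def[symmetric] q_def[symmetric] by simp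
qed

theorem theorem3p1:
  fixes \<beta> \<mu> :: real and n m :: nat
  assumes "\<beta> < 1" and "n \<ge> 2" and "m \<ge> 2"
  shows "let B = (if 0 \<le> \<mu> \<and> \<mu> \<le> (real n * real m) / ((1 - \<beta>) * (real n + real m - 1))
                  then 2 * (1 - \<beta>) / (real n + real m - 1)
                  else \<bar>4 * \<mu> * (1 - \<beta>)^2 / (real n * real m)
                        - 2 * (1 - \<beta>) / (real n + real m - 1)\<bar>)
    in (\<forall>f a. f \<in> class_R \<beta> \<longrightarrow> normalized_expansion f a \<longrightarrow>
          norm (of_real \<mu> * a n * a m - a (n + m - 1)) \<le> B) \<and>
       (\<exists>f a. f \<in> class_R \<beta> \<and> normalized_expansion f a \<and>
          norm (of_real \<mu> * a n * a m - a (n + m - 1)) = B)"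
proof -
  define \<nu> where "\<nu> = \<mu> * (1 - \<beta>) * (real n + real m - 1) / (real n * real m)"
  define A where "A = (1 - \<beta>) / (real n + real m - 1)"
  define M where "M = (if 0 \<le> \<nu> \<and> \<nu> \<le> 1 then 2 else \<bar>4 * \<nu> - 2\<bar>)"
  have "A \<ge> 0" using assms by (simp add: A_def)
  note rescale = coefficient_functional_rescale[OF assms(2,3,1), where \<mu> = \<mu>,
      folded \<nu>_def A_def]
  have bound: "norm (of_real \<mu> * a n * a m - a (n + m - 1)) \<le> A * M"
    if f: "f \<in> class_R \<beta>" "normalized_expansion f a" for f a
  proof -
    obtain p P where pP: "p holomorphic_on ball 0 1" "p has_fps_expansion P" "p 0 = 1"
      "\<And>z. z \<in> ball 0 1 \<Longrightarrow> Re (p z) > 0"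
      and a: "\<And>n. n \<ge> 2 \<Longrightarrow> a n = of_real ((1 - \<beta>) / real n) * fps_nth P (n - 1)"
      by (rule class_R_positive_real_part[OF assms(1) f]) blast
    have "norm (of_real \<mu> * a n * a m - a (n + m - 1)) =
        A * norm (of_real \<nu> * fps_nth P (n - 1) * fps_nth P (m - 1) - fps_nth P ((n - 1) + (m - 1)))"
      by (rule rescale) (rule a)
    also have "\<dots> \<le> A * M"
      unfolding M_def using assms \<open>A \<ge> 0\<close>
      by (intro mult_left_mono norm_coeff_functional_le[OF pP]) auto
    finally show ?thesis .
  qed
  have sharp: "\<exists>f a. f \<in> class_R \<beta> \<and> normalized_expansion f a \<and>
      norm (of_real \<mu> * a n * a m - a (n + m - 1)) = A * M"
  proof -
    \<comment> \<open>\<open>j + k\<close> divides neither \<open>j\<close> nor \<open>k\<close>, so the product vanishes and only \<open>c\<^bsub>j+k\<^esub> = 2\<close> is left;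
      \<open>N = 1\<close> gives \<open>\<nu> \<cdot> 2 \<cdot> 2 - 2\<close>.\<close>
    define N where "N = (if 0 \<le> \<nu> \<and> \<nu> \<le> 1 then (n - 1) + (m - 1) else 1)"
    define c :: "nat \<Rightarrow> complex" where "c l = (if N dvd l then 2 else 0)" for l
    have "N \<ge> 1" using assms by (auto simp: N_def)
    then obtain f a where fa: "f \<in> class_R \<beta>" "normalized_expansion f a"
      and a: "\<And>n. n \<ge> 2 \<Longrightarrow>
        a n = of_real ((1 - \<beta>) / real n) * (if N dvd n - 1 then 2 else 0)"
      using class_R_extremal[OF assms(1)] by blast
    have "norm (of_real \<nu> * c (n - 1) * c (m - 1) - c ((n - 1) + (m - 1))) = M"
    proof (cases "0 \<le> \<nu> \<and> \<nu> \<le> 1")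
      case True
      then have N: "N = (n - 1) + (m - 1)" by (simp add: N_def)
      have "\<not> N dvd n - 1" using assms by (auto simp: N dest: dvd_imp_le)
      then have "c (n - 1) = 0" "c ((n - 1) + (m - 1)) = 2" by (simp_all add: c_def N)
      then show ?thesis using True by (simp add: M_def)
    next
      case False
      then have "N = 1" unfolding N_def by (rule if_not_P)
      then have "of_real \<nu> * c (n - 1) * c (m - 1) - c ((n - 1) + (m - 1)) = of_real (4 * \<nu> - 2)"
        by (simp add: c_def)
      then show ?thesis using False by (simp only: norm_of_real M_def if_False)
    qed
    moreover have "norm (of_real \<mu> * a n * a m - a (n + m - 1)) =
        A * norm (of_real \<nu> * c (n - 1) * c (m - 1) - c ((n - 1) + (m - 1)))"
      by (rule rescale) (unfold c_def, rule a)
    ultimately have "norm (of_real \<mu> * a n * a m - a (n + m - 1)) = A * M" by (simp only:)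
    with fa show ?thesis by blast
  qed
  show ?thesis
    unfolding coefficient_bound_rescale[OF assms(2,3,1), where \<mu> = \<mu>, folded \<nu>_def A_def] Let_def
    by (intro conjI allI impI bound[unfolded M_def] sharp[unfolded M_def])
qed

end
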